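(* Let $(A,\rho)$ be a compact infinite metric space and let $N\ge 2$ be a fixed integer. Let $\omega_N$ be a cluster point as $s\to\infty$ of a family of $N$-point $s$-energy minimizing configurations on $A$. Then $\gamma(\omega_N,A)\le 1$.
   Context: For a configuration $\omega_N=\{x_1,\ldots,x_N\}\subset A$ of $N\ge 2$ distinct points: the separation distance is $\delta(\omega_N):=\min_{1\le i\ne j\le N}\rho(x_i,x_j)$; the mesh norm (covering radius) relative to $A$ is $\eta(\omega_N,A):=\max_{y\in A}\min_{1\le i\le N}\rho(y,x_i)$; the mesh-separation ratio is $\gamma(\omega_N,A):=\eta(\omega_N,A)/\delta(\omega_N)$. For $s>0$ the Riesz $s$-energy of $\omega_N$ is $E_s(\omega_N):=\sum_{1\le i\ne j\le N}\rho(x_i,x_j)^{-s}$ (sum over ordered pairs), and $\mathcal E_s(A,N):=\inf\{E_s(\omega_N):\omega_N\subset A,\ \#\omega_N=N\}$. An $N$-point configuration $\omega_N\subset A$ is $s$-energy minimizing if $E_s(\omega_N)=\mathcal E_s(A,N)$. Given a family $\{\omega_{N,s}\}_{s>0}$ of $N$-point configurations, $\omega_N=\{x_1,\dots,x_N\}$ is a cluster point as $s\to\infty$ if there are $s_k\to\infty$ and labelings $\omega_{N,s_k}=\{x_1^{(k)},\dots,x_N^{(k)}\}$ with $x_i^{(k)}\to x_i$ for each $i=1,\dots,N$. *)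

theory Defs
  imports "HOL-Analysis.Analysis"
begin

definition off_diag :: "'a set \<Rightarrow> ('a \<times> 'a) set" where
  "off_diag \<omega> = {(x, y). x \<in> \<omega> \<and> y \<in> \<omega> \<and> x \<noteq> y}"

text \<open>The minima below are the intended ones for finite \<open>\<omega>\<close> (with at least two points for
  the separation distance).\<close>

definition separation_dist :: "'a::metric_space set \<Rightarrow> real" where
  "separation_dist \<omega> = Min ((\<lambda>(x, y). dist x y) ` off_diag \<omega>)"

text \<open>For nonempty compact \<open>A\<close> and finite nonempty \<open>\<omega>\<close> the supremum is attained,
  so it is the maximum over \<open>A\<close>.\<close>

definition mesh_norm :: "'a::metric_space set \<Rightarrow> 'a set \<Rightarrow> real" where
  "mesh_norm \<omega> A = (SUP y\<in>A. Min ((\<lambda>x. dist y x) ` \<omega>))"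

definition mesh_ratio :: "'a::metric_space set \<Rightarrow> 'a set \<Rightarrow> real" where
  "mesh_ratio \<omega> A = mesh_norm \<omega> A / separation_dist \<omega>"

definition riesz_energy :: "real \<Rightarrow> 'a::metric_space set \<Rightarrow> real" where
  "riesz_energy s \<omega> = (\<Sum>(x, y)\<in>off_diag \<omega>. dist x y powr (- s))"

definition configurations :: "'a set \<Rightarrow> nat \<Rightarrow> 'a set set" where
  "configurations A N = {\<omega>. \<omega> \<subseteq> A \<and> finite \<omega> \<and> card \<omega> = N}"

definition min_riesz_energy :: "real \<Rightarrow> 'a::metric_space set \<Rightarrow> nat \<Rightarrow> real" where
  "min_riesz_energy s A N = (INF \<omega>\<in>configurations A N. riesz_energy s \<omega>)"

definition energy_minimizing :: "real \<Rightarrow> 'a::metric_space set \<Rightarrow> nat \<Rightarrow> 'a set \<Rightarrow> bool" where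
  "energy_minimizing s A N \<omega> \<longleftrightarrow>
     \<omega> \<in> configurations A N \<and> riesz_energy s \<omega> = min_riesz_energy s A N"

text \<open>Only the labelings \<open>x k\<close> of the family members are required to be injective; the limit
  points \<open>p i\<close> are not assumed distinct, nor to lie in any particular set.\<close>

definition cluster_point_at_infinity ::
    "nat \<Rightarrow> (real \<Rightarrow> 'a::metric_space set) \<Rightarrow> 'a set \<Rightarrow> bool" where
  "cluster_point_at_infinity N \<Omega> \<omega> \<longleftrightarrow>
     (\<exists>(s :: nat \<Rightarrow> real) (x :: nat \<Rightarrow> nat \<Rightarrow> 'a) (p :: nat \<Rightarrow> 'a).
        (\<forall>k. s k > 0) \<and> filterlim s at_top sequentially \<and>
        (\<forall>k. bij_betw (x k) {1..N} (\<Omega> (s k))) \<and>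
        \<omega> = p ` {1..N} \<and>
        (\<forall>i\<in>{1..N}. (\<lambda>k. x k i) \<longlonglongrightarrow> p i))"

end

(*
  In an energy minimizer no point x can be moved profitably to a point y of A outside the
  configuration, so for every other point z the single term dist x z powr (-s) is at most the
  potential at y of the remaining points. Raising to the power 1/s and letting s tend to infinity
  gives: for any two indices i, l and any y in A, some limit point p j is within
  dist (p i) (p l) of y. Taking p i = p l would make A finite, so the limit points are distinct;
  taking a closest pair bounds the mesh norm by the separation distance.
*)
theory Submission
  imports Defs
begin

text \<open>The energy runs over ordered pairs: each new \<open>v\<close> enters as (x, v) and as
  (v, x), with equal terms because the distance is symmetric. Hence the factor 2.\<close>

lemma riesz_energy_insert:
  assumes "finite V" "x \<notin> V"
  shows "riesz_energy s (insert x V) = riesz_energy s V + 2 * (\<Sum>v\<in>V. dist x v powr (- s))"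
proof -
  let ?f = "\<lambda>(x, y). dist x y powr (- s)"
  have decomp: "off_diag (insert x V) = off_diag V \<union> (Pair x ` V \<union> (\<lambda>v. (v, x)) ` V)"
    using assms by (auto simp: off_diag_def)
  have fin: "finite (off_diag V)"
    by (rule finite_subset[of _ "V \<times> V"]) (use assms in \<open>auto simp: off_diag_def\<close>)
  have "riesz_energy s (insert x V)
      = sum ?f (off_diag V) + (sum ?f (Pair x ` V) + sum ?f ((\<lambda>v. (v, x)) ` V))"
    unfolding riesz_energy_def decomp
    using assms fin
    by (subst sum.union_disjoint, auto simp: off_diag_def)+
  also have "sum ?f (Pair x ` V) = (\<Sum>v\<in>V. dist x v powr (- s))"
    by (subst sum.reindex) (auto simp: inj_on_def)
  also have "sum ?f ((\<lambda>v. (v, x)) ` V) = (\<Sum>v\<in>V. dist x v powr (- s))"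
    by (subst sum.reindex) (auto simp: inj_on_def dist_commute)
  finally show ?thesis by (simp add: riesz_energy_def)
qed

text \<open>Supplies the bound below that makes the real-valued \<open>INF\<close> of the energies a
  genuine lower bound.\<close>

lemma riesz_energy_nonneg: "riesz_energy s \<omega> \<ge> 0"
  unfolding riesz_energy_def by (rule sum_nonneg) auto

lemma min_riesz_energy_le:
  assumes "\<omega> \<in> configurations A N"
  shows "min_riesz_energy s A N \<le> riesz_energy s \<omega>"
  unfolding min_riesz_energy_def
  by (rule cINF_lower[OF _ assms]) (auto intro!: bdd_belowI2[of _ 0] riesz_energy_nonneg)

text \<open>Replacing \<open>x\<close> by \<open>y\<close> gives another N-point configuration,
  whose energy is no smaller. Both energies contain that of \<open>W - {x}\<close>, which cancels
  and leaves twice the potentials.\<close>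

lemma energy_minimizing_potential_le:
  assumes min: "energy_minimizing s A N W" and "x \<in> W" "y \<in> A" "y \<notin> W"
  shows "(\<Sum>v\<in>W - {x}. dist x v powr (- s)) \<le> (\<Sum>v\<in>W - {x}. dist y v powr (- s))"
proof -
  let ?V = "W - {x}"
  have W: "W \<subseteq> A" "finite W" "card W = N"
    using min by (auto simp: energy_minimizing_def configurations_def)
  have "card (insert y ?V) = N"
    using W assms card_Suc_Diff1[of W x] by simp
  then have "insert y ?V \<in> configurations A N"
    using W assms by (auto simp: configurations_def)
  then have "riesz_energy s W \<le> riesz_energy s (insert y ?V)"
    using min_riesz_energy_le min by (metis energy_minimizing_def)
  moreover have "insert x ?V = W" using assms by auto
  ultimately show ?thesis
    using riesz_energy_insert[of ?V x s] riesz_energy_insert[of ?V y s] W assms by simp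
qed

text \<open>The crude factor N, in place of N - 1, is harmless: its s-th root tends to 1 as s
  grows.\<close>

lemma energy_minimizing_dist_powr_le:
  assumes min: "energy_minimizing s A N W" and "s > 0"
    and "x \<in> W" "z \<in> W" "z \<noteq> x" "y \<in> A" "b > 0" and far: "\<And>v. v \<in> W \<Longrightarrow> b \<le> dist y v"
  shows "dist x z powr (- s) \<le> real N * b powr (- s)"
proof -
  have W: "finite W" "card W = N"
    using min by (auto simp: energy_minimizing_def configurations_def)
  have "y \<notin> W" using far[of y] \<open>b > 0\<close> by auto
  have "dist x z powr (- s) \<le> (\<Sum>v\<in>W - {x}. dist x v powr (- s))"
    using W assms by (intro member_le_sum) auto
  also have "\<dots> \<le> (\<Sum>v\<in>W - {x}. dist y v powr (- s))"
    using energy_minimizing_potential_le assms \<open>y \<notin> W\<close> by blast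
  also have "\<dots> \<le> (\<Sum>v\<in>W - {x}. b powr (- s))"
    using assms by (intro sum_mono powr_mono2') auto
  also have "\<dots> \<le> real N * b powr (- s)"
    using W by (auto intro!: mult_right_mono card_mono simp: card_Diff_subset_Int)
  finally show ?thesis .
qed

text \<open>Only the indices \<open>i\<close> and \<open>l\<close> have to differ. The case
  \<open>p i = p l\<close> is deliberately included, since it later serves to show that the limit
  points are distinct.\<close>

lemma cluster_point_covering:
  fixes A :: "'a::metric_space set" and x :: "nat \<Rightarrow> nat \<Rightarrow> 'a"
  assumes min: "\<And>k. energy_minimizing (s k) A N (W k)"
    and pos: "\<And>k. s k > 0" and lim: "filterlim s at_top sequentially"
    and bij: "\<And>k. bij_betw (x k) I (W k)" and I: "finite I"
    and conv: "\<And>j. j \<in> I \<Longrightarrow> (\<lambda>k. x k j) \<longlonglongrightarrow> p j"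
    and il: "i \<in> I" "l \<in> I" "i \<noteq> l" and "y \<in> A"
  shows "\<exists>j\<in>I. dist y (p j) \<le> dist (p i) (p l)"
proof (rule ccontr)
  assume "\<not> ?thesis"
  then have far: "\<And>j. j \<in> I \<Longrightarrow> dist (p i) (p l) < dist y (p j)" by force
  \<comment> \<open>As \<open>I\<close> is finite, the strict inequalities \<open>far\<close> leave
    a uniform gap. Two numbers a < b are placed in it: for large k, a exceeds the distance of the
    pair and b stays below all distances from \<open>y\<close>.\<close>
  define M where "M = Min ((\<lambda>j. dist y (p j)) ` I)"
  have "dist (p i) (p l) < M"
    unfolding M_def using I il far by (subst Min_gr_iff) auto
  then obtain b where b: "dist (p i) (p l) < b" "b < M" using dense by blast
  then obtain a where a: "dist (p i) (p l) < a" "a < b" using dense by blast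
  have "a > 0" using a(1) zero_le_dist[of "p i" "p l"] by linarith
  have "\<forall>\<^sub>F k in sequentially. dist (x k i) (x k l) < a"
    using order_tendstoD(2)[OF tendsto_dist[OF conv[OF il(1)] conv[OF il(2)]] a(1)] .
  moreover have "\<forall>\<^sub>F k in sequentially. \<forall>j\<in>I. b < dist y (x k j)"
  proof (rule eventually_ball_finite[OF I], rule ballI)
    fix j assume j: "j \<in> I"
    then have "b < dist y (p j)"
      using b(2) I unfolding M_def by (meson Min_le finite_imageI imageI less_le_trans)
    then show "\<forall>\<^sub>F k in sequentially. b < dist y (x k j)"
      using order_tendstoD(1)[OF tendsto_dist[OF tendsto_const conv[OF j]]] by blast
  qed
  \<comment> \<open>The threshold is chosen so that \<open>(b / a) powr s k\<close> exceeds N + 1,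
    whereas minimality will bound it by N.\<close>
  moreover have "\<forall>\<^sub>F k in sequentially. ln (real N + 1) / ln (b / a) < s k"
    using lim by (simp add: filterlim_at_top_dense)
  ultimately have "\<forall>\<^sub>F k in sequentially. False"
  proof eventually_elim
    case (elim k)
    have mem: "x k i \<in> W k" "x k l \<in> W k" "x k l \<noteq> x k i"
      using bij[of k] il by (auto simp: bij_betw_def inj_on_def)
    have "b \<le> dist y v" if "v \<in> W k" for v
      using elim(2) bij[of k] that by (force simp: bij_betw_def)
    then have "dist (x k i) (x k l) powr (- s k) \<le> real N * b powr (- s k)"
      using energy_minimizing_dist_powr_le[OF min pos mem \<open>y \<in> A\<close>] a(2) \<open>a > 0\<close> by simp
    \<comment> \<open>Injectivity of the labeling makes this distance positive; at distance 0 the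
      inequality would fail, since \<open>0 powr (- s k)\<close> is 0.\<close>
    moreover have "a powr (- s k) \<le> dist (x k i) (x k l) powr (- s k)"
      using elim(1) mem pos[of k] by (intro powr_mono2') auto
    ultimately have "a powr (- s k) \<le> real N * b powr (- s k)" by linarith
    then have "(b / a) powr s k \<le> real N"
      using a(2) \<open>a > 0\<close> by (simp add: powr_minus powr_divide field_simps)
    moreover have "ln (b / a) > 0" using a(2) \<open>a > 0\<close> by simp
    then have "ln (real N + 1) < s k * ln (b / a)"
      using elim(3) by (simp add: field_simps)
    then have "ln (real N + 1) < ln ((b / a) powr s k)"
      by (simp add: ln_powr)
    then have "real N + 1 < (b / a) powr s k"
      using a(2) \<open>a > 0\<close> by (subst (asm) ln_less_cancel_iff) auto
    ultimately show False by linarith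
  qed
  then show False by simp
qed

theorem theorem3:
  fixes A :: "'a::metric_space set" and N :: nat
    and \<Omega> :: "real \<Rightarrow> 'a set" and \<omega> :: "'a set"
  assumes "compact A" and "infinite A" and "N \<ge> 2"
    and "\<And>s. s > 0 \<Longrightarrow> energy_minimizing s A N (\<Omega> s)"
    and "cluster_point_at_infinity N \<Omega> \<omega>"
  shows "mesh_ratio \<omega> A \<le> 1"
proof -
  obtain s x p where pos: "\<And>k. s k > (0::real)" and lim: "filterlim s at_top sequentially"
    and bij: "\<And>k. bij_betw (x k) {1..N} (\<Omega> (s k))" and \<omega>: "\<omega> = p ` {1..N}"
    and conv: "\<And>i. i \<in> {1..N} \<Longrightarrow> (\<lambda>k. x k i) \<longlonglongrightarrow> p i"
    using assms(5) unfolding cluster_point_at_infinity_def by blast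
  have cover: "\<exists>j\<in>{1..N}. dist y (p j) \<le> dist (p i) (p l)"
    if "i \<in> {1..N}" "l \<in> {1..N}" "i \<noteq> l" "y \<in> A" for i l y
    using cluster_point_covering[OF assms(4)[OF pos] pos lim bij _ conv] that by blast
  have "p i \<noteq> p l" if "i \<in> {1..N}" "l \<in> {1..N}" "i \<noteq> l" for i l
  proof
    assume "p i = p l"
    then have "A \<subseteq> p ` {1..N}" using cover[OF that] by force
    then show False using \<open>infinite A\<close> finite_surj by blast
  qed
  \<comment> \<open>The indices 1 and 2 exist as N \<ge> 2, so the \<open>Min\<close> in
    \<open>separation_dist\<close> is over a nonempty set and is attained.\<close>
  from this[of 1 2] have ne: "off_diag \<omega> \<noteq> {}"
    using \<open>N \<ge> 2\<close> by (force simp: \<omega> off_diag_def)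
  have fin: "finite (off_diag \<omega>)"
    by (rule finite_subset[of _ "\<omega> \<times> \<omega>"]) (auto simp: off_diag_def \<omega>)
  have "separation_dist \<omega> \<in> (\<lambda>(x, y). dist x y) ` off_diag \<omega>"
    unfolding separation_dist_def using fin ne by (intro Min_in) auto
  then obtain i l where il: "i \<in> {1..N}" "l \<in> {1..N}" "p i \<noteq> p l"
    and sep: "separation_dist \<omega> = dist (p i) (p l)"
    by (auto simp: off_diag_def \<omega>)
  have "mesh_norm \<omega> A \<le> separation_dist \<omega>"
    unfolding mesh_norm_def
  proof (rule cSUP_least)
    show "A \<noteq> {}" using \<open>infinite A\<close> by auto
    fix y assume "y \<in> A"
    moreover have "i \<noteq> l" using il by blast
    ultimately obtain j where "j \<in> {1..N}" "dist y (p j) \<le> separation_dist \<omega>"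
      using cover[OF il(1,2)] unfolding sep by blast
    \<comment> \<open>One limit point close to \<open>y\<close> suffices to bound the
      minimum.\<close>
    then show "Min ((\<lambda>x. dist y x) ` \<omega>) \<le> separation_dist \<omega>"
      unfolding \<omega> by (subst Min_le_iff) auto
  qed
  moreover have "separation_dist \<omega> > 0" using sep il by simp
  ultimately show ?thesis by (simp add: mesh_ratio_def)
qed

end
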